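(* Let $n\in\mathbb{N}$, let $E\subseteq\mathbb{R}^n$ be a (Lebesgue) measurable set, and let $\mathcal{F}$ be a family of real-valued measurable functions on $E$. Extend each $f\in\mathcal{F}$ by zero outside $E$, so that $f$ is defined on all of $\mathbb{R}^n$. Consider the truncated translation condition $$\lim_{|y|\to 0}\ \sup_{f\in\mathcal{F}}\int_{\mathbb{R}^n}\min\big(|f(x+y)-f(x)|,1\big)\,\mathrm{d}x=0. \qquad (\ast)$$ Then: (i) If $\mathcal{F}$ satisfies $(\ast)$, then $\mathcal{F}$ is almost equicontinuous on $E$. (ii) Conversely, if $|E|<\infty$ and $\mathcal{F}$ is almost equicontinuous on $E$, then $(\ast)$ holds.
   Context: For a measurable set $A\subseteq\mathbb{R}^n$, $|A|$ denotes its Lebesgue measure; integrals are with respect to Lebesgue measure. The integrals and the supremum in the truncated translation condition take values in $[0,\infty]$, and $y$ ranges over $\mathbb{R}^n$. A family $\mathcal{F}$ of real-valued measurable functions on $E$ is said to be almost equicontinuous on $E$ if, for each $\varepsilon>0$, there exists $\delta>0$ such that, for every $f\in\mathcal{F}$, there is a measurable set $B_f\subseteq E$ with $|B_f|<\varepsilon$ and $$|f(x_1)-f(x_2)|<\varepsilon$$ whenever $x_1,x_2\in E\setminus B_f$ satisfy $|x_1-x_2|<\delta$. (Here $\delta$ depends only on $\varepsilon$, not on $f$, while $B_f$ may depend on both $f$ and $\varepsilon$.) *)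

theory Defs
  imports "HOL-Analysis.Analysis"
begin

text \<open>
  A function on \<open>E\<close> is represented by a total function of which only the values on \<open>E\<close> matter;
  both notions below are insensitive to its values outside \<open>E\<close>.
\<close>

definition zero_extension :: "'a set \<Rightarrow> ('a \<Rightarrow> real) \<Rightarrow> 'a \<Rightarrow> real" where
  "zero_extension E f = (\<lambda>x. if x \<in> E then f x else 0)"

definition almost_equicontinuous_on ::
    "'a::euclidean_space set \<Rightarrow> ('a \<Rightarrow> real) set \<Rightarrow> bool" where
  "almost_equicontinuous_on E F \<longleftrightarrow>
    (\<forall>\<epsilon>>0. \<exists>\<delta>>0. \<forall>f\<in>F. \<exists>B\<in>sets lebesgue. B \<subseteq> E \<and> emeasure lebesgue B < ennreal \<epsilon> \<and>
      (\<forall>x1\<in>E - B. \<forall>x2\<in>E - B. norm (x1 - x2) < \<delta> \<longrightarrow> \<bar>f x1 - f x2\<bar> < \<epsilon>))"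

text \<open>
  The integral and the supremum are taken in \<^typ>\<open>ennreal\<close>, so they are always defined and may
  be infinite; the supremum over the empty family is 0.
\<close>

definition truncated_translation_condition ::
    "'a::euclidean_space set \<Rightarrow> ('a \<Rightarrow> real) set \<Rightarrow> bool" where
  "truncated_translation_condition E F \<longleftrightarrow>
    ((\<lambda>y. SUP f\<in>F. \<integral>\<^sup>+ x. ennreal (min \<bar>zero_extension E f (x + y) - zero_extension E f x\<bar> 1) \<partial>lebesgue)
      \<longlongrightarrow> 0) (at 0)"

end

theory Submission
  imports Defs
begin

text \<open>
  Write \<open>g\<close> for the zero extension of \<open>f\<close>.

  Small translation integrals give almost equicontinuity by averaging. If the truncated integral
  is at most \<open>\<eta>\<close> for every \<open>y\<close> with \<open>\<bar>y\<bar> < \<rho>\<close>, then by Tonelli the function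
  \<open>h x = \<integral>\<^bsub>\<bar>y\<bar> < \<rho>\<^esub> min \<bar>g (x + y) - g x\<bar> 1 dy\<close> has integral at most \<open>\<eta>\<close> times the volume of the
  ball of radius \<open>\<rho>\<close>, so by Markov's inequality it is below a threshold \<open>c\<close> outside a set \<open>B\<close> of
  controlled measure. For two points outside \<open>B\<close> at distance less than \<open>\<rho> / 2\<close>, the values of \<open>g\<close>
  on the ball of radius \<open>\<rho> / 2\<close> about the first point are, on average, close to both \<open>g x1\<close> and
  \<open>g x2\<close>; hence \<open>g x1\<close> and \<open>g x2\<close> are close to each other. This is
  \<open>small_translation_integrals_imp_slow_variation\<close>. The two balls have the volume ratio \<open>2\<^sup>n\<close> for
  every \<open>\<rho>\<close>. So \<open>\<eta>\<close> can be chosen from \<open>\<epsilon>\<close> alone, before the translation condition supplies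
  \<open>\<rho>\<close>; the resulting \<open>\<delta> = \<rho> / 2\<close> is the same for the whole family.

  Conversely, let \<open>\<bar>y\<bar> < \<delta>\<close>. If \<open>x\<close> and \<open>x + y\<close> both lie in \<open>E\<close> outside the exceptional set \<open>B\<close>, the
  integrand is below \<open>\<epsilon>\<close>, which contributes at most \<open>\<epsilon>\<close> times the measure of \<open>E\<close>. In all other
  cases it is at most 1, and it vanishes unless \<open>x \<in> B\<close>, or \<open>x + y \<in> B\<close>, or exactly one of \<open>x\<close>
  and \<open>x + y\<close> lies in \<open>E\<close>. The first two sets have measure below \<open>\<epsilon>\<close>, and so do the sets of points
  that the translation moves out of \<open>E\<close> or into \<open>E\<close>, once \<open>y\<close> is small, by
  \<open>emeasure_leaving_under_small_translation\<close>.
\<close>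

section \<open>Translations and Lebesgue measure\<close>

lemma lebesgue_translate_preimage:
  fixes A :: "'a::euclidean_space set"
  assumes "A \<in> sets lebesgue"
  shows "{x. x + y \<in> A} \<in> sets lebesgue"
    and "emeasure lebesgue {x. x + y \<in> A} = emeasure lebesgue A"
proof -
  have eq: "{x. x + y \<in> A} = (\<lambda>x. - y + x) ` A"
    by (force simp: image_iff)
  show "{x. x + y \<in> A} \<in> sets lebesgue"
    unfolding eq by (rule lebesgue_sets_translation[OF assms])
  have "{x. x + y \<in> A} = (\<lambda>x. 1 *\<^sub>R x + (- y)) ` A"
    by (force simp: image_iff)
  then show "emeasure lebesgue {x. x + y \<in> A} = emeasure lebesgue A"
    using emeasure_lebesgue_affine[of 1 "- y" A] by simp
qed

lemma nn_integral_lborel_translate: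
  fixes h :: "'a::euclidean_space \<Rightarrow> ennreal"
  assumes [measurable]: "h \<in> borel_measurable borel"
  shows "(\<integral>\<^sup>+ x. h (x - a) \<partial>lborel) = (\<integral>\<^sup>+ x. h x \<partial>lborel)"
proof -
  have "(\<integral>\<^sup>+ x. h x \<partial>lborel) = (\<integral>\<^sup>+ x. h x \<partial>distr lborel borel ((+) (- a)))"
    by (simp only: lborel_distr_plus)
  also have "\<dots> = (\<integral>\<^sup>+ x. h (- a + x) \<partial>lborel)"
    by (subst nn_integral_distr) auto
  finally show ?thesis by simp
qed

text \<open>
  Inner regularity by closed sets leaves a set that may be unbounded; as \<open>E\<close> has finite measure,
  cutting it off with a large ball loses arbitrarily little.
\<close>

lemma lebesgue_inner_compact:
  fixes E :: "'a::euclidean_space set"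
  assumes E: "E \<in> sets lebesgue" "emeasure lebesgue E < \<infinity>" and "e > 0"
  obtains K where "compact K" "K \<subseteq> E" "emeasure lebesgue (E - K) < ennreal e"
proof -
  obtain C where C: "closed C" "C \<subseteq> E" "E - C \<in> lmeasurable" "emeasure lebesgue (E - C) < ennreal (e/2)"
    using sets_lebesgue_inner_closed[OF E(1), of "e/2"] \<open>e > 0\<close> by auto
  have "(\<lambda>i::nat. emeasure lebesgue (E - cball 0 (real i)))
      \<longlonglongrightarrow> emeasure lebesgue (\<Inter>i::nat. E - cball 0 (real i))"
  proof (rule Lim_emeasure_decseq)
    show "range (\<lambda>i::nat. E - cball 0 (real i)) \<subseteq> sets lebesgue"
      using E by auto
    show "decseq (\<lambda>i::nat. E - cball 0 (real i))"
      by (auto simp: decseq_def)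
    fix i :: nat
    have "emeasure lebesgue (E - cball 0 (real i)) \<le> emeasure lebesgue E"
      by (rule emeasure_mono) (use E in auto)
    then show "emeasure lebesgue (E - cball 0 (real i)) \<noteq> \<infinity>"
      using E(2) by (auto simp: top_unique)
  qed
  moreover have "(\<Inter>i::nat. E - cball 0 (real i)) = {}"
  proof -
    have "\<exists>i::nat. x \<in> cball 0 (real i)" for x :: 'a
      by (simp add: real_arch_simple)
    then show ?thesis by blast
  qed
  ultimately have "(\<lambda>i::nat. emeasure lebesgue (E - cball 0 (real i))) \<longlonglongrightarrow> 0"
    by (simp only: emeasure_empty)
  then have "eventually (\<lambda>i::nat. emeasure lebesgue (E - cball 0 (real i)) < ennreal (e/2)) sequentially"
    by (rule order_tendstoD(2)) (use \<open>e > 0\<close> in auto)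
  then obtain i :: nat where i: "emeasure lebesgue (E - cball 0 (real i)) < ennreal (e/2)"
    by (auto simp: eventually_sequentially)
  show thesis
  proof
    show "compact (C \<inter> cball 0 (real i))"
      using C(1) by (simp add: closed_Int_compact)
    show "C \<inter> cball 0 (real i) \<subseteq> E" using C(2) by auto
    have "E - C \<inter> cball 0 (real i) = (E - C) \<union> (E - cball 0 (real i))" by auto
    then have "emeasure lebesgue (E - C \<inter> cball 0 (real i))
        \<le> emeasure lebesgue (E - C) + emeasure lebesgue (E - cball 0 (real i))"
      using C(3) E(1) by (simp only:) (intro emeasure_subadditive; auto)
    also have "\<dots> < ennreal (e/2 + e/2)"
      using C(4) i by (rule add_mono_ennreal)
    also have "\<dots> = ennreal e"
      by simp
    finally show "emeasure lebesgue (E - C \<inter> cball 0 (real i)) < ennreal e" .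
  qed
qed

text \<open>
  Squeeze \<open>E\<close> between a compact \<open>K\<close> and an open \<open>U\<close> of almost the same measure. A translation
  shorter than the distance from \<open>K\<close> to the complement of \<open>U\<close> keeps \<open>K\<close> inside \<open>U\<close>, so a point
  that leaves \<open>E\<close> either started in \<open>E - K\<close> or landed in \<open>U - E\<close>.
\<close>

lemma emeasure_leaving_under_small_translation:
  fixes E :: "'a::euclidean_space set"
  assumes E: "E \<in> sets lebesgue" "emeasure lebesgue E < \<infinity>" and "e > 0"
  obtains d where "d > 0"
    "\<And>y. norm y < d \<Longrightarrow> emeasure lebesgue {x \<in> E. x + y \<notin> E} < ennreal e"
proof -
  obtain K where K: "compact K" "K \<subseteq> E" "emeasure lebesgue (E - K) < ennreal (e/2)"
    using lebesgue_inner_compact[OF E, of "e/2"] \<open>e > 0\<close> by auto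
  obtain U where U: "open U" "E \<subseteq> U" "U - E \<in> lmeasurable" "emeasure lebesgue (U - E) < ennreal (e/2)"
    using sets_lebesgue_outer_open[OF E(1), of "e/2"] \<open>e > 0\<close> by auto
  obtain d where d: "d > 0" "(\<Union>x\<in>K. ball x d) \<subseteq> U"
    using compact_subset_open_imp_ball_epsilon_subset[OF K(1) U(1)] K(2) U(2) by blast
  show thesis
  proof (rule that[OF d(1)])
    fix y :: 'a assume y: "norm y < d"
    have "x + y \<in> U" if "x \<in> K" for x
    proof -
      have "x + y \<in> ball x d" using y by (simp add: dist_norm)
      then show ?thesis using d(2) that by blast
    qed
    then have "{x \<in> E. x + y \<notin> E} \<subseteq> (E - K) \<union> {x. x + y \<in> U - E}"
      by auto
    moreover have KE: "E - K \<in> sets lebesgue"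
      using E(1) K(1) by (simp add: borel_compact sets.Diff)
    moreover note UE = lebesgue_translate_preimage[of "U - E" y]
    ultimately have "emeasure lebesgue {x \<in> E. x + y \<notin> E}
        \<le> emeasure lebesgue ((E - K) \<union> {x. x + y \<in> U - E})"
      using U(3) by (intro emeasure_mono) auto
    also have "\<dots> \<le> emeasure lebesgue (E - K) + emeasure lebesgue {x. x + y \<in> U - E}"
      using KE UE U(3) by (intro emeasure_subadditive) auto
    also have "\<dots> < ennreal (e/2 + e/2)"
    proof (rule add_mono_ennreal[OF K(3)])
      show "emeasure lebesgue {x. x + y \<in> U - E} < ennreal (e/2)"
        using UE(2) U(3,4) by (simp only: fmeasurableD)
    qed
    also have "\<dots> = ennreal e"
      by simp
    finally show "emeasure lebesgue {x \<in> E. x + y \<notin> E} < ennreal e" .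
  qed
qed

section \<open>From small translation integrals to almost equicontinuity\<close>

text \<open>
  The averaging argument for a single function, with all constants explicit so that the choice
  of \<open>c\<close> and \<open>\<eta>\<close> can be made uniformly over a family.
\<close>

lemma small_translation_integrals_imp_slow_variation:
  fixes g :: "'a::euclidean_space \<Rightarrow> real"
  assumes g: "g \<in> borel_measurable lebesgue"
    and "0 < \<rho>" "0 < c" "0 \<le> \<eta>"
    and small: "\<And>y. norm y < \<rho> \<Longrightarrow>
      (\<integral>\<^sup>+ x. ennreal (min \<bar>g (x + y) - g x\<bar> 1) \<partial>lebesgue) \<le> ennreal \<eta>"
  obtains B where "B \<in> sets lebesgue"
    "ennreal c * emeasure lebesgue B \<le> ennreal (\<eta> * measure lborel (ball (0::'a) \<rho>))"
    "\<And>x1 x2. x1 \<notin> B \<Longrightarrow> x2 \<notin> B \<Longrightarrow> norm (x1 - x2) < \<rho> / 2 \<Longrightarrow>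
      min \<bar>g x1 - g x2\<bar> 1 * measure lborel (ball (0::'a) (\<rho> / 2)) < 2 * c"
proof -
  \<comment> \<open>Joint measurability of \<open>g (x + y)\<close>, needed for Tonelli, is immediate only for a Borel function;
     so \<open>g\<close> is replaced by a Borel representative and the null set \<open>N\<close> is added to \<open>B\<close>.\<close>
  obtain k where k[measurable]: "k \<in> borel_measurable borel" and gk: "AE x in lborel. g x = k x"
    using completion_ex_borel_measurable_real[OF g] by auto
  have gk': "AE x in lebesgue. g x = k x"
    using gk by (simp add: AE_completion_iff)
  define N where "N = {x. g x \<noteq> k x}"
  have N: "N \<in> null_sets lebesgue"
  proof -
    have k': "k \<in> borel_measurable lebesgue"
      by (rule measurable_completion) simp
    have "{x \<in> space lebesgue. \<not> g x = k x} \<in> sets lebesgue"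
      using g k' by measurable
    then have "{x \<in> space lebesgue. \<not> g x = k x} \<in> null_sets lebesgue"
      using gk' by (simp only: AE_iff_null)
    then show ?thesis by (simp add: N_def)
  qed
  define \<phi> where "\<phi> x y = ennreal (min \<bar>k (x + y) - k x\<bar> 1)" for x y
  have \<phi>[measurable]: "case_prod \<phi> \<in> borel_measurable (lborel \<Otimes>\<^sub>M lborel)"
    unfolding \<phi>_def by measurable
  have [measurable]: "ball (0::'a) \<rho> \<in> sets lborel"
    by simp
  have small_k: "(\<integral>\<^sup>+ x. \<phi> x y \<partial>lborel) \<le> ennreal \<eta>" if "norm y < \<rho>" for y
  proof -
    have "{x. x + y \<in> N} \<in> null_sets lebesgue"
      using N lebesgue_translate_preimage[of N y] by (auto simp: null_sets_def)
    then have "AE x in lebesgue. g (x + y) = k (x + y)"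
      by (rule AE_I') (auto simp: N_def)
    then have "AE x in lebesgue. \<phi> x y = ennreal (min \<bar>g (x + y) - g x\<bar> 1)"
      using gk' by eventually_elim (simp add: \<phi>_def)
    then have "(\<integral>\<^sup>+ x. \<phi> x y \<partial>lebesgue) = (\<integral>\<^sup>+ x. ennreal (min \<bar>g (x + y) - g x\<bar> 1) \<partial>lebesgue)"
      by (rule nn_integral_cong_AE)
    then show ?thesis
      using small[OF that] by (simp add: nn_integral_completion)
  qed
  define h where "h x = (\<integral>\<^sup>+ y. \<phi> x y * indicator (ball 0 \<rho>) y \<partial>lborel)" for x
  have h[measurable]: "h \<in> borel_measurable borel"
    unfolding h_def \<phi>_def by measurable
  have ballV: "emeasure lborel (ball z r) = ennreal (measure lborel (ball (0::'a) r))" if "0 < r" for z :: 'a and r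
    using that content_ball_conv_unit_ball[of r z] content_ball_conv_unit_ball[of r "0::'a"]
      emeasure_eq_ennreal_measure[of lborel "ball z r"] emeasure_lborel_ball_finite[of z r]
    by auto
  have "(\<integral>\<^sup>+ x. h x \<partial>lborel) = (\<integral>\<^sup>+ y. (\<integral>\<^sup>+ x. \<phi> x y * indicator (ball 0 \<rho>) y \<partial>lborel) \<partial>lborel)"
    unfolding h_def by (rule lborel_pair.Fubini'[symmetric]) measurable
  also have "\<dots> \<le> (\<integral>\<^sup>+ y. ennreal \<eta> * indicator (ball (0::'a) \<rho>) y \<partial>lborel)"
    by (intro nn_integral_mono) (auto simp: indicator_def small_k)
  also have "\<dots> = ennreal (\<eta> * measure lborel (ball (0::'a) \<rho>))"
    using \<open>0 \<le> \<eta>\<close> \<open>0 < \<rho>\<close> by (simp add: nn_integral_cmult ballV ennreal_mult)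
  finally have inth: "(\<integral>\<^sup>+ x. h x \<partial>lborel) \<le> ennreal (\<eta> * measure lborel (ball (0::'a) \<rho>))" .
  define A where "A = {x. ennreal c \<le> h x}"
  have A[measurable]: "A \<in> sets borel"
    unfolding A_def by measurable
  show thesis
  proof
    show "A \<union> N \<in> sets lebesgue"
      using N A by auto
    have "emeasure lebesgue (A \<union> N) = emeasure lebesgue A"
      using N A by (intro emeasure_Un_null_set) auto
    also have "\<dots> = emeasure lborel A"
      using A by (simp add: emeasure_completion)
    also have "ennreal c * \<dots> = (\<integral>\<^sup>+ x. ennreal c * indicator A x \<partial>lborel)"
      by (simp add: nn_integral_cmult)
    also have "\<dots> \<le> (\<integral>\<^sup>+ x. h x \<partial>lborel)"
      by (intro nn_integral_mono) (auto simp: indicator_def A_def)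
    finally show "ennreal c * emeasure lebesgue (A \<union> N) \<le> ennreal (\<eta> * measure lborel (ball (0::'a) \<rho>))"
      using inth by (simp add: order_trans)
  next
    fix x1 x2 assume x: "x1 \<notin> A \<union> N" "x2 \<notin> A \<union> N" "norm (x1 - x2) < \<rho> / 2"
    have h_eq: "h x = (\<integral>\<^sup>+ z. \<phi> x (z - x) * indicator (ball 0 \<rho>) (z - x) \<partial>lborel)" for x
      unfolding h_def by (subst nn_integral_lborel_translate) (auto simp: \<phi>_def)
    define t where "t = min \<bar>k x1 - k x2\<bar> 1"
    have "ennreal t * ennreal (measure lborel (ball (0::'a) (\<rho> / 2)))
        = (\<integral>\<^sup>+ z. ennreal t * indicator (ball x1 (\<rho> / 2)) z \<partial>lborel)"
      using ballV[of "\<rho> / 2" x1] \<open>0 < \<rho>\<close> by (subst nn_integral_cmult_indicator) auto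
    \<comment> \<open>The ball of radius \<open>\<rho> / 2\<close> about \<open>x1\<close> lies in the balls of radius \<open>\<rho>\<close> about \<open>x1\<close> and \<open>x2\<close>, and on
       it the truncated triangle inequality holds pointwise.\<close>
    also have "\<dots> \<le> (\<integral>\<^sup>+ z. \<phi> x1 (z - x1) * indicator (ball 0 \<rho>) (z - x1)
        + \<phi> x2 (z - x2) * indicator (ball 0 \<rho>) (z - x2) \<partial>lborel)"
    proof (intro nn_integral_mono)
      fix z :: 'a
      show "ennreal t * indicator (ball x1 (\<rho> / 2)) z
        \<le> \<phi> x1 (z - x1) * indicator (ball 0 \<rho>) (z - x1) + \<phi> x2 (z - x2) * indicator (ball 0 \<rho>) (z - x2)"
      proof (cases "z \<in> ball x1 (\<rho> / 2)")
        case True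
        then have z1: "norm (z - x1) < \<rho> / 2"
          by (simp add: dist_norm norm_minus_commute)
        moreover have "norm (z - x2) \<le> norm (z - x1) + norm (x1 - x2)"
          using norm_triangle_ineq[of "z - x1" "x1 - x2"] by simp
        ultimately have "norm (z - x1) < \<rho>" "norm (z - x2) < \<rho>"
          using x(3) \<open>0 < \<rho>\<close> by linarith+
        moreover have "ennreal t \<le> \<phi> x1 (z - x1) + \<phi> x2 (z - x2)"
        proof -
          have "t \<le> min \<bar>k z - k x1\<bar> 1 + min \<bar>k z - k x2\<bar> 1"
            unfolding t_def by arith
          from ennreal_leI[OF this] show ?thesis
            by (simp add: \<phi>_def)
        qed
        ultimately show ?thesis by (auto simp: indicator_def)
      qed simp
    qed
    also have "\<dots> = h x1 + h x2"
      unfolding h_eq by (intro nn_integral_add) (auto simp: \<phi>_def)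
    also have "\<dots> < ennreal (c + c)"
    proof (rule add_mono_ennreal)
      show "h x1 < ennreal c" "h x2 < ennreal c"
        using x(1,2) by (auto simp: A_def not_le)
    qed
    finally have "ennreal (t * measure lborel (ball (0::'a) (\<rho> / 2))) < ennreal (2 * c)"
      using \<open>0 < c\<close> by (simp add: ennreal_mult' t_def flip: ennreal_plus)
    then have "t * measure lborel (ball (0::'a) (\<rho> / 2)) < 2 * c"
      using \<open>0 < c\<close> by (simp add: ennreal_less_iff t_def)
    then show "min \<bar>g x1 - g x2\<bar> 1 * measure lborel (ball (0::'a) (\<rho> / 2)) < 2 * c"
      using x by (auto simp: N_def t_def)
  qed
qed

lemma zero_extension_measurable:
  fixes E :: "'a::euclidean_space set"
  assumes "E \<in> sets lebesgue" "f \<in> borel_measurable (lebesgue_on E)"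
  shows "zero_extension E f \<in> borel_measurable lebesgue"
  unfolding zero_extension_def using assms by (intro borel_measurable_if_I)

lemma truncated_translation_imp_almost_equicontinuous:
  fixes E :: "'a::euclidean_space set"
  assumes E: "E \<in> sets lebesgue"
    and meas: "\<And>f. f \<in> F \<Longrightarrow> f \<in> borel_measurable (lebesgue_on E)"
    and tr: "truncated_translation_condition E F"
  shows "almost_equicontinuous_on E F"
  unfolding almost_equicontinuous_on_def
proof (intro allI impI)
  fix \<epsilon>' :: real assume "\<epsilon>' > 0"
  \<comment> \<open>Below 1 the truncation is harmless: \<open>min a 1 < \<epsilon>\<close> forces \<open>a < \<epsilon>\<close>.\<close>
  define \<epsilon> where "\<epsilon> = min \<epsilon>' 1"
  have \<epsilon>: "0 < \<epsilon>" "\<epsilon> \<le> 1" "\<epsilon> \<le> \<epsilon>'"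
    using \<open>\<epsilon>' > 0\<close> by (auto simp: \<epsilon>_def)
  \<comment> \<open>With \<open>c = \<epsilon> * V / 2\<close> below, \<open>V\<close> being the volume of a ball of radius \<open>\<rho> / 2\<close>, the exceptional
     set has measure at most \<open>\<eta> * 2\<^sup>n * V / c = \<epsilon> / 2\<close>, and \<open>g\<close> varies by less than
     \<open>2 * c / V = \<epsilon>\<close>. The radius \<open>\<rho>\<close> cancels.\<close>
  define \<eta> where "\<eta> = \<epsilon>\<^sup>2 / (4 * 2 ^ DIM('a))"
  have "\<eta> > 0" using \<epsilon> by (simp add: \<eta>_def)
  have "eventually (\<lambda>y. (SUP f\<in>F. \<integral>\<^sup>+ x. ennreal (min \<bar>zero_extension E f (x + y) - zero_extension E f x\<bar> 1)
      \<partial>lebesgue) < ennreal \<eta>) (at 0)"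
    by (rule order_tendstoD(2)[OF tr[unfolded truncated_translation_condition_def]])
      (use \<open>\<eta> > 0\<close> in auto)
  then obtain \<rho> where \<rho>: "\<rho> > 0" and sup: "\<And>y. y \<noteq> 0 \<Longrightarrow> norm y < \<rho> \<Longrightarrow>
     (SUP f\<in>F. \<integral>\<^sup>+ x. ennreal (min \<bar>zero_extension E f (x + y) - zero_extension E f x\<bar> 1)
      \<partial>lebesgue) < ennreal \<eta>"
    by (auto simp: eventually_at)
  define V where "V = measure lborel (ball (0::'a) (\<rho> / 2))"
  have V: "V > 0" "measure lborel (ball (0::'a) \<rho>) = 2 ^ DIM('a) * V"
    using \<rho> content_ball_conv_unit_ball[of "\<rho>/2" "0::'a"] content_ball_conv_unit_ball[of \<rho> "0::'a"]
      content_ball_pos[of "\<rho>/2" "0::'a"]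
    by (auto simp: V_def power_divide)
  define c where "c = \<epsilon> * V / 2"
  have "c > 0" using \<epsilon> V by (simp add: c_def)
  show "\<exists>\<delta>>0. \<forall>f\<in>F. \<exists>B\<in>sets lebesgue. B \<subseteq> E \<and> emeasure lebesgue B < ennreal \<epsilon>' \<and>
      (\<forall>x1\<in>E - B. \<forall>x2\<in>E - B. norm (x1 - x2) < \<delta> \<longrightarrow> \<bar>f x1 - f x2\<bar> < \<epsilon>')"
  proof (intro exI[of _ "\<rho> / 2"] conjI ballI)
    fix f assume f: "f \<in> F"
    let ?g = "zero_extension E f"
    have small: "(\<integral>\<^sup>+ x. ennreal (min \<bar>?g (x + y) - ?g x\<bar> 1) \<partial>lebesgue) \<le> ennreal \<eta>"
      if "norm y < \<rho>" for y
      \<comment> \<open>The limit says nothing about \<open>y = 0\<close>, where the integrand is 0.\<close>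
    proof (cases "y = 0")
      case False
      have "(\<integral>\<^sup>+ x. ennreal (min \<bar>?g (x + y) - ?g x\<bar> 1) \<partial>lebesgue)
        \<le> (SUP f\<in>F. \<integral>\<^sup>+ x. ennreal (min \<bar>zero_extension E f (x + y) - zero_extension E f x\<bar> 1) \<partial>lebesgue)"
        by (rule SUP_upper[OF f])
      then show ?thesis
        using sup[OF False that] by simp
    qed simp
    obtain B where B: "B \<in> sets lebesgue"
      "ennreal c * emeasure lebesgue B \<le> ennreal (\<eta> * measure lborel (ball (0::'a) \<rho>))"
      "\<And>x1 x2. x1 \<notin> B \<Longrightarrow> x2 \<notin> B \<Longrightarrow> norm (x1 - x2) < \<rho> / 2 \<Longrightarrow>
        min \<bar>?g x1 - ?g x2\<bar> 1 * V < 2 * c"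
      using small_translation_integrals_imp_slow_variation[OF
          zero_extension_measurable[OF E meas[OF f]] \<rho> \<open>c > 0\<close> less_imp_le[OF \<open>\<eta> > 0\<close>] small]
      unfolding V_def by metis
    have "\<eta> * measure lborel (ball (0::'a) \<rho>) = c * (\<epsilon> / 2)"
      using V by (simp add: \<eta>_def c_def power2_eq_square)
    then have "ennreal (\<eta> * measure lborel (ball (0::'a) \<rho>)) = ennreal c * ennreal (\<epsilon> / 2)"
      using \<open>c > 0\<close> \<epsilon> by (simp only: ennreal_mult less_imp_le half_gt_zero)
    with B(2) have "ennreal c * emeasure lebesgue B \<le> ennreal c * ennreal (\<epsilon> / 2)"
      by (simp only:)
    then have "emeasure lebesgue B \<le> ennreal (\<epsilon> / 2)"
      using \<open>c > 0\<close> by (simp add: ennreal_mult_le_mult_iff)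
    moreover have "emeasure lebesgue (B \<inter> E) \<le> emeasure lebesgue B"
      using B(1) by (intro emeasure_mono) auto
    moreover have "ennreal (\<epsilon> / 2) < ennreal \<epsilon>'"
      using \<epsilon> by (intro ennreal_lessI) auto
    ultimately have "emeasure lebesgue (B \<inter> E) < ennreal \<epsilon>'"
      by (meson order.strict_trans1 order_trans)
    moreover have "\<bar>f x1 - f x2\<bar> < \<epsilon>'"
      if "x1 \<in> E - B \<inter> E" "x2 \<in> E - B \<inter> E" "norm (x1 - x2) < \<rho> / 2" for x1 x2
    proof -
      have "min \<bar>f x1 - f x2\<bar> 1 * V < \<epsilon> * V"
        using B(3)[of x1 x2] that by (auto simp: zero_extension_def c_def)
      then have "min \<bar>f x1 - f x2\<bar> 1 < \<epsilon>"
        using V(1) by simp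
      then show ?thesis using \<epsilon> by auto
    qed
    ultimately show "\<exists>B\<in>sets lebesgue. B \<subseteq> E \<and> emeasure lebesgue B < ennreal \<epsilon>' \<and>
      (\<forall>x1\<in>E - B. \<forall>x2\<in>E - B. norm (x1 - x2) < \<rho> / 2 \<longrightarrow> \<bar>f x1 - f x2\<bar> < \<epsilon>')"
      using B(1) E by (intro bexI[of _ "B \<inter> E"]) auto
  qed (use \<rho> in auto)
qed

section \<open>From almost equicontinuity to small translation integrals\<close>

lemma almost_equicontinuous_imp_truncated_translation:
  fixes E :: "'a::euclidean_space set"
  assumes E: "E \<in> sets lebesgue" "emeasure lebesgue E < \<infinity>"
    and ae: "almost_equicontinuous_on E F"
  shows "truncated_translation_condition E F"
  unfolding truncated_translation_condition_def
proof (rule order_tendstoI)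
  fix a :: ennreal assume "0 < a"
  then obtain b where b: "0 < b" "b < a" by (rule dense[THEN exE]) blast
  then obtain e where e: "b = ennreal e" "e > 0"
    by (cases b) (auto simp: ennreal_less_zero_iff)
  define m where "m = measure lebesgue E"
  have m: "m \<ge> 0" "emeasure lebesgue E = ennreal m"
    unfolding m_def using E(2) by (simp, intro emeasure_eq_ennreal_measure) simp
  \<comment> \<open>One \<open>\<epsilon> * m\<close> from the good part of \<open>E\<close> and four exceptional sets of measure at most \<open>\<epsilon>\<close>.\<close>
  define \<epsilon> where "\<epsilon> = e / (m + 4)"
  have "\<epsilon> * (m + 4) = e"
    using m by (simp add: \<epsilon>_def)
  then have "\<epsilon> * m + \<epsilon> + \<epsilon> + \<epsilon> + \<epsilon> = e"
    by (simp add: distrib_left)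
  moreover have "\<epsilon> > 0"
    using e m by (simp add: \<epsilon>_def)
  ultimately have \<epsilon>: "\<epsilon> > 0" "\<epsilon> * m + \<epsilon> + \<epsilon> + \<epsilon> + \<epsilon> = e"
    by blast+
  obtain \<delta> where \<delta>: "\<delta> > 0" and B_ex: "\<And>f. f \<in> F \<Longrightarrow> \<exists>B\<in>sets lebesgue. B \<subseteq> E \<and> emeasure lebesgue B < ennreal \<epsilon> \<and>
      (\<forall>x1\<in>E - B. \<forall>x2\<in>E - B. norm (x1 - x2) < \<delta> \<longrightarrow> \<bar>f x1 - f x2\<bar> < \<epsilon>)"
    using ae[unfolded almost_equicontinuous_on_def, rule_format, OF \<epsilon>(1)] by blast
  obtain d where d: "d > 0" "\<And>y. norm y < d \<Longrightarrow> emeasure lebesgue {x \<in> E. x + y \<notin> E} < ennreal \<epsilon>"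
    using emeasure_leaving_under_small_translation[OF E \<epsilon>(1)] by blast
  have "(SUP f\<in>F. \<integral>\<^sup>+ x. ennreal (min \<bar>zero_extension E f (x + y) - zero_extension E f x\<bar> 1) \<partial>lebesgue) < a"
    if y: "norm y < min \<delta> d" for y
  proof -
    have "(\<integral>\<^sup>+ x. ennreal (min \<bar>zero_extension E f (x + y) - zero_extension E f x\<bar> 1) \<partial>lebesgue) \<le> b"
      if f: "f \<in> F" for f
    proof -
      obtain B where B: "B \<in> sets lebesgue" "B \<subseteq> E" "emeasure lebesgue B < ennreal \<epsilon>"
        "\<And>x1 x2. x1 \<in> E - B \<Longrightarrow> x2 \<in> E - B \<Longrightarrow> norm (x1 - x2) < \<delta> \<Longrightarrow> \<bar>f x1 - f x2\<bar> < \<epsilon>"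
        using B_ex[OF f] by blast
      define B' where "B' = {x. x + y \<in> B}"
      define L where "L = {x \<in> E. x + y \<notin> E}"
      \<comment> \<open>The points carried into \<open>E\<close> are the preimage, under translation by \<open>y\<close>, of those that leave
         \<open>E\<close> under \<open>- y\<close>.\<close>
      define L' where "L' = {x. x + y \<in> {z \<in> E. z + (- y) \<notin> E}}"
      have leave: "{x \<in> E. x + z \<notin> E} \<in> sets lebesgue" for z
      proof -
        have "{x \<in> E. x + z \<notin> E} = E - {x. x + z \<in> E}" by auto
        then show ?thesis
          using E(1) lebesgue_translate_preimage(1)[OF E(1)] by (simp only:) (rule sets.Diff)
      qed
      have [measurable]: "B' \<in> sets lebesgue" "L \<in> sets lebesgue" "L' \<in> sets lebesgue"
        "E \<in> sets lebesgue" "B \<in> sets lebesgue"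
        using B(1) E(1) leave lebesgue_translate_preimage(1) unfolding B'_def L_def L'_def by blast+
      have bounds: "emeasure lebesgue B' \<le> ennreal \<epsilon>" "emeasure lebesgue L \<le> ennreal \<epsilon>"
        "emeasure lebesgue L' \<le> ennreal \<epsilon>" "emeasure lebesgue B \<le> ennreal \<epsilon>"
        using lebesgue_translate_preimage(2)[OF B(1), of y] B(3) d(2)[of y] d(2)[of "- y"] y
          lebesgue_translate_preimage(2)[OF leave[of "- y"], of y]
        unfolding B'_def L_def L'_def by (auto intro: less_imp_le)
      have "(\<integral>\<^sup>+ x. ennreal (min \<bar>zero_extension E f (x + y) - zero_extension E f x\<bar> 1) \<partial>lebesgue)
        \<le> (\<integral>\<^sup>+ x. ennreal \<epsilon> * indicator E x + indicator B x + indicator B' x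
            + indicator L x + indicator L' x \<partial>lebesgue)"
      proof (intro nn_integral_mono)
        fix x
        let ?l = "min \<bar>zero_extension E f (x + y) - zero_extension E f x\<bar> 1"
        let ?r = "\<epsilon> * indicator E x + indicator B x + indicator B' x + indicator L x + indicator L' x :: real"
        have "?l \<le> ?r"
        proof (cases "x \<in> E - B \<and> x + y \<in> E - B")
          case True
          then have "\<bar>f (x + y) - f x\<bar> < \<epsilon>"
            using y by (intro B(4)) auto
          with True \<epsilon>(1) show ?thesis
            by (auto simp: zero_extension_def indicator_def)
        next
          case False
          then show ?thesis
            using \<epsilon>(1) B(2)
            by (auto simp: zero_extension_def indicator_def B'_def L_def L'_def)
        qed
        then have "ennreal ?l \<le> ennreal ?r" by (rule ennreal_leI)
        also have "\<dots> = ennreal \<epsilon> * indicator E x + indicator B x + indicator B' x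
            + indicator L x + indicator L' x"
          using \<epsilon>(1) by (simp add: ennreal_mult ennreal_indicator)
        finally show "ennreal ?l \<le> \<dots>" .
      qed
      also have "\<dots> = ennreal \<epsilon> * emeasure lebesgue E + emeasure lebesgue B + emeasure lebesgue B'
          + emeasure lebesgue L + emeasure lebesgue L'"
        by (simp add: nn_integral_add nn_integral_cmult del: emeasure_completion)
      also have "\<dots> \<le> ennreal \<epsilon> * ennreal m + ennreal \<epsilon> + ennreal \<epsilon> + ennreal \<epsilon> + ennreal \<epsilon>"
        using bounds m by (intro add_mono) (auto simp del: emeasure_completion)
      also have "\<dots> = ennreal (\<epsilon> * m + \<epsilon> + \<epsilon> + \<epsilon> + \<epsilon>)"
        using less_imp_le[OF \<epsilon>(1)] m(1)
        by (simp only: ennreal_mult ennreal_plus add_nonneg_nonneg mult_nonneg_nonneg)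
      also have "\<dots> = b" using \<epsilon>(2) e by simp
      finally show ?thesis .
    qed
    then show ?thesis
      by (intro order.strict_trans1[OF SUP_least b(2)])
  qed
  then show "eventually (\<lambda>y. (SUP f\<in>F. \<integral>\<^sup>+ x. ennreal (min \<bar>zero_extension E f (x + y) - zero_extension E f x\<bar> 1)
      \<partial>lebesgue) < a) (at 0)"
    unfolding eventually_at using \<delta> d(1) by (intro exI[of _ "min \<delta> d"]) auto
qed simp

theorem theorem1p1:
  fixes E :: "(real ^ 'n) set" and F :: "(real ^ 'n \<Rightarrow> real) set"
  assumes "E \<in> sets lebesgue"
    and "\<And>f. f \<in> F \<Longrightarrow> f \<in> borel_measurable (lebesgue_on E)"
  shows "(truncated_translation_condition E F \<longrightarrow> almost_equicontinuous_on E F) \<and>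
    (emeasure lebesgue E < \<infinity> \<and> almost_equicontinuous_on E F
      \<longrightarrow> truncated_translation_condition E F)"
proof (intro conjI impI)
  assume "truncated_translation_condition E F"
  then show "almost_equicontinuous_on E F"
    using truncated_translation_imp_almost_equicontinuous assms by blast
next
  assume "emeasure lebesgue E < \<infinity> \<and> almost_equicontinuous_on E F"
  then show "truncated_translation_condition E F"
    using almost_equicontinuous_imp_truncated_translation[OF assms(1)] by blast
qed

end
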